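(* Let $p\in\{a,\sigma,\tau\}$. A Tychonoff space $X$ is universally $p$-measure zero (i.e. $M_p(X)=M_d(X)$) if and only if $X$ is universally $p$-measurable (i.e. $M_p(X)=M_R(X)$) and every compact subset of $X$ is scattered.
   Context: $\beta X$ is the Stone–Čech compactification, and $M(\beta X)$ is the set of finite signed regular Borel measures on $\beta X$; $|\mu|$ is the total variation. The following are subsets of $M(\beta X)$. $M_d(X)$: those $\mu$ concentrated on some countable subset of $X$; $M_R(X)$: those $\mu$ concentrated on some $\sigma$-compact subset of $X$; $M_\tau(X)$: those $\mu$ with $|\mu|(K)=0$ for all compact $K\subset\beta X\setminus X$; $M_\sigma(X)$: those $\mu$ with $|\mu|(K)=0$ for all compact $K\subset\beta X\setminus X$ of type $G_\delta$ in $\beta X$; $M_a(X)=M(\beta X)$. Here "$\mu$ is concentrated on $S$" means $|\mu|(\beta X\setminus S)=0$. A space is scattered if each of its nonempty subspaces has an isolated point. *)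

theory Defs
  imports "HOL-Analysis.Analysis"
begin

text \<open>
  The space \<open>\<beta>X\<close> is the closure of the image of \<open>X\<close> under the evaluation map into the cube
  indexed by all continuous \<open>f : X \<rightarrow> [0,1]\<close>. Functions are taken extensional, so that each
  continuous map on the carrier is one index. Subsets of \<open>X\<close>, as subsets of \<open>\<beta>X\<close>, are the
  images under \<open>stone_cech_embed X\<close>.
\<close>

definition unit_interval_maps :: "'a topology \<Rightarrow> ('a \<Rightarrow> real) set" where
  "unit_interval_maps X =
     {f \<in> extensional (topspace X). continuous_map X (top_of_set {0..1}) f}"

definition stone_cech_embed :: "'a topology \<Rightarrow> 'a \<Rightarrow> ('a \<Rightarrow> real) \<Rightarrow> real" where
  "stone_cech_embed X x = (\<lambda>f\<in>unit_interval_maps X. f x)"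

definition stone_cech_cube :: "'a topology \<Rightarrow> (('a \<Rightarrow> real) \<Rightarrow> real) topology" where
  "stone_cech_cube X = product_topology (\<lambda>f. top_of_set {0..1}) (unit_interval_maps X)"

definition stone_cech :: "'a topology \<Rightarrow> (('a \<Rightarrow> real) \<Rightarrow> real) topology" where
  "stone_cech X = subtopology (stone_cech_cube X)
     (stone_cech_cube X closure_of (stone_cech_embed X ` topspace X))"

lemma stone_cech_embed_in_cube:
  "stone_cech_embed X ` topspace X \<subseteq> topspace (stone_cech_cube X)"
proof -
  have "f x \<in> {0..1}" if "f \<in> unit_interval_maps X" "x \<in> topspace X" for f x
    using that continuous_map_image_subset_topspace by (fastforce simp: unit_interval_maps_def)
  then show ?thesis
    unfolding stone_cech_cube_def stone_cech_embed_def[abs_def]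
    by (auto simp: PiE_iff)
qed

lemma topspace_stone_cech:
  "topspace (stone_cech X) = stone_cech_cube X closure_of (stone_cech_embed X ` topspace X)"
  by (simp add: stone_cech_def closure_of_subset_topspace inf_absorb2)

lemma compact_space_stone_cech: "compact_space (stone_cech X)"
proof -
  have "compact_space (stone_cech_cube X)"
    unfolding stone_cech_cube_def
    by (auto simp: compact_space_product_topology compact_space_subtopology)
  then show ?thesis
    unfolding stone_cech_def
    by (simp add: closedin_compact_space compact_space_subtopology)
qed

lemma Hausdorff_space_stone_cech: "Hausdorff_space (stone_cech X)"
  unfolding stone_cech_def stone_cech_cube_def
  by (intro Hausdorff_space_subtopology)
     (simp add: Hausdorff_space_product_topology Hausdorff_space_subtopology)

lemma stone_cech_embed_dense:
  "stone_cech X closure_of (stone_cech_embed X ` topspace X) = topspace (stone_cech X)"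
  unfolding topspace_stone_cech unfolding stone_cech_def
  by (simp add: closure_of_subtopology closure_of_subset stone_cech_embed_in_cube Int_absorb1)

lemma embedding_map_stone_cech_embed:
  assumes "completely_regular_space X" "Hausdorff_space X"
  shows "embedding_map X (stone_cech X) (stone_cech_embed X)"
proof -
  have eq: "mspace (submetric (cfunspace X euclidean_metric) {f. f \<in> topspace X \<rightarrow> {0..1}})
      = unit_interval_maps X"
    by (auto simp: unit_interval_maps_def continuous_map_in_subtopology
        image_subset_iff intro: bounded_subset[OF bounded_closed_interval[of 0 1]])
  have "embedding_map X (stone_cech_cube X) (stone_cech_embed X)"
    using completely_regular_space_cube_embedding_explicit[OF assms]
    unfolding eq stone_cech_cube_def stone_cech_embed_def[abs_def] .
  then show ?thesis
    unfolding stone_cech_def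
    by (simp add: embedding_map_in_subtopology closure_of_subset stone_cech_embed_in_cube)
qed

lemma stone_cech_extension:
  fixes g :: "'a \<Rightarrow> real"
  assumes "continuous_map X (top_of_set {0..1}) g"
  obtains h where "continuous_map (stone_cech X) (top_of_set {0..1}) h"
    "\<And>x. x \<in> topspace X \<Longrightarrow> h (stone_cech_embed X x) = g x"
proof
  let ?g = "restrict g (topspace X)"
  have g: "?g \<in> unit_interval_maps X"
    unfolding unit_interval_maps_def using assms continuous_map_eq by fastforce
  show "continuous_map (stone_cech X) (top_of_set {0..1}) (\<lambda>y. y ?g)"
    unfolding stone_cech_def stone_cech_cube_def
    by (intro continuous_map_from_subtopology continuous_map_product_projection g)
  show "stone_cech_embed X x ?g = g x" if "x \<in> topspace X" for x
    using that g by (simp add: stone_cech_embed_def)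
qed

definition borel_sets :: "'a topology \<Rightarrow> 'a set set" where
  "borel_sets T = sigma_sets (topspace T) {U. openin T U}"

text \<open>
  A signed measure is a real-valued countably additive set function; it is extended by
  \<^term>\<open>undefined\<close> outside the Borel sets, so that equality of functions is equality of measures.
  Countable additivity forces the value 0 on the empty set.
\<close>

definition finite_signed_borel_measure :: "'a topology \<Rightarrow> ('a set \<Rightarrow> real) \<Rightarrow> bool" where
  "finite_signed_borel_measure T \<mu> \<longleftrightarrow>
     \<mu> \<in> extensional (borel_sets T) \<and>
     (\<forall>A :: nat \<Rightarrow> 'a set. range A \<subseteq> borel_sets T \<and> disjoint_family A
        \<longrightarrow> (\<lambda>n. \<mu> (A n)) sums \<mu> (\<Union>n. A n))"

definition total_variation :: "'a topology \<Rightarrow> ('a set \<Rightarrow> real) \<Rightarrow> 'a set \<Rightarrow> ennreal" where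
  "total_variation T \<mu> E =
     (SUP P \<in> {P. finite P \<and> P \<subseteq> borel_sets T \<and> disjoint P \<and> \<Union>P \<subseteq> E}.
        ennreal (\<Sum>A\<in>P. \<bar>\<mu> A\<bar>))"

definition regular_borel_measure :: "'a topology \<Rightarrow> ('a set \<Rightarrow> real) \<Rightarrow> bool" where
  "regular_borel_measure T \<mu> \<longleftrightarrow>
     (\<forall>E \<in> borel_sets T.
        total_variation T \<mu> E = (INF U \<in> {U. openin T U \<and> E \<subseteq> U}. total_variation T \<mu> U) \<and>
        total_variation T \<mu> E = (SUP K \<in> {K. compactin T K \<and> K \<subseteq> E}. total_variation T \<mu> K))"

definition signed_regular_borel_measures :: "'a topology \<Rightarrow> ('a set \<Rightarrow> real) set" where
  "signed_regular_borel_measures T =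
     {\<mu>. finite_signed_borel_measure T \<mu> \<and> regular_borel_measure T \<mu>}"

definition concentrated_on :: "'a topology \<Rightarrow> ('a set \<Rightarrow> real) \<Rightarrow> 'a set \<Rightarrow> bool" where
  "concentrated_on T \<mu> S \<longleftrightarrow> total_variation T \<mu> (topspace T - S) = 0"

type_synonym 'a stone_cech_measure = "(('a \<Rightarrow> real) \<Rightarrow> real) set \<Rightarrow> real"

definition sigma_compactin :: "'a topology \<Rightarrow> 'a set \<Rightarrow> bool" where
  "sigma_compactin T = countable union_of compactin T"

definition stone_cech_remainder :: "'a topology \<Rightarrow> (('a \<Rightarrow> real) \<Rightarrow> real) set" where
  "stone_cech_remainder X = topspace (stone_cech X) - stone_cech_embed X ` topspace X"

definition M_a :: "'a topology \<Rightarrow> 'a stone_cech_measure set" where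
  "M_a X = signed_regular_borel_measures (stone_cech X)"

definition M_sigma :: "'a topology \<Rightarrow> 'a stone_cech_measure set" where
  "M_sigma X = {\<mu> \<in> signed_regular_borel_measures (stone_cech X).
     \<forall>K. compactin (stone_cech X) K \<and> gdelta_in (stone_cech X) K \<and> K \<subseteq> stone_cech_remainder X
       \<longrightarrow> total_variation (stone_cech X) \<mu> K = 0}"

definition M_tau :: "'a topology \<Rightarrow> 'a stone_cech_measure set" where
  "M_tau X = {\<mu> \<in> signed_regular_borel_measures (stone_cech X).
     \<forall>K. compactin (stone_cech X) K \<and> K \<subseteq> stone_cech_remainder X
       \<longrightarrow> total_variation (stone_cech X) \<mu> K = 0}"

definition M_R :: "'a topology \<Rightarrow> 'a stone_cech_measure set" where
  "M_R X = {\<mu> \<in> signed_regular_borel_measures (stone_cech X).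
     \<exists>S. sigma_compactin X S \<and> concentrated_on (stone_cech X) \<mu> (stone_cech_embed X ` S)}"

definition M_d :: "'a topology \<Rightarrow> 'a stone_cech_measure set" where
  "M_d X = {\<mu> \<in> signed_regular_borel_measures (stone_cech X).
     \<exists>S. S \<subseteq> topspace X \<and> countable S \<and>
       concentrated_on (stone_cech X) \<mu> (stone_cech_embed X ` S)}"

datatype measure_class = Class_a | Class_sigma | Class_tau

fun M_class :: "measure_class \<Rightarrow> 'a topology \<Rightarrow> 'a stone_cech_measure set" where
  "M_class Class_a X = M_a X"
| "M_class Class_sigma X = M_sigma X"
| "M_class Class_tau X = M_tau X"

definition universally_measure_zero :: "measure_class \<Rightarrow> 'a topology \<Rightarrow> bool" where
  "universally_measure_zero p X \<longleftrightarrow> M_class p X = M_d X"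

definition universally_measurable :: "measure_class \<Rightarrow> 'a topology \<Rightarrow> bool" where
  "universally_measurable p X \<longleftrightarrow> M_class p X = M_R X"

definition scattered_space :: "'a topology \<Rightarrow> bool" where
  "scattered_space T \<longleftrightarrow>
     (\<forall>S. S \<subseteq> topspace T \<and> S \<noteq> {} \<longrightarrow> (\<exists>x\<in>S. openin (subtopology T S) {x}))"

end

theory Submission
  imports Defs
begin

text \<open>
  Since \<open>M_d X \<subseteq> M_R X \<subseteq> M_p X\<close> always holds, it suffices that \<open>M_R X \<subseteq> M_d X\<close> iff all compact
  subsets of \<open>X\<close> are scattered. If they are, a measure without atoms on a compact \<open>L \<subseteq> X\<close> vanishes,
  because an isolated point of its support would be an atom.

  If a compact \<open>K\<close> is not scattered, it contains a dense-in-itself set \<open>S\<close>, hence a binary tree of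
  open sets \<open>U w\<close> meeting \<open>S\<close>, siblings having disjoint closures. Choose \<open>x w \<in> U w \<inter> S\<close>; the uniform
  distributions on the \<open>2^n\<close> points of level \<open>n\<close> have, by Tychonoff, a pointwise cluster point \<open>m\<close>,
  which is finitely additive on all subsets. Every point has a neighbourhood meeting at most one
  \<open>U w\<close> of level \<open>k\<close>, hence of \<open>m\<close>-value at most \<open>2^-k\<close>. Caratheodory's construction from \<open>m\<close> on the
  compact sets gives an atomless regular Borel measure carried by \<open>K\<close>.
\<close>

section \<open>Null sets of signed Borel measures\<close>

lemma sigma_algebra_borel_sets: "sigma_algebra (topspace T) (borel_sets T)"
  unfolding borel_sets_def
  by (rule sigma_algebra_sigma_sets) (auto dest: openin_subset)

lemma openin_borel_sets: "openin T U \<Longrightarrow> U \<in> borel_sets T"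
  by (simp add: borel_sets_def sigma_sets.Basic)

lemma closedin_borel_sets:
  assumes "closedin T C"
  shows "C \<in> borel_sets T"
proof -
  interpret sigma_algebra "topspace T" "borel_sets T" by (rule sigma_algebra_borel_sets)
  have "topspace T - (topspace T - C) \<in> borel_sets T"
    using assms by (intro compl_sets openin_borel_sets) auto
  then show ?thesis
    using closedin_subset[OF assms] by (simp add: double_diff)
qed

text \<open>A single Borel subset of \<open>E\<close> is already an admissible family, so nullity
  reduces to vanishing on Borel subsets. Since \<open>E\<close> may be arbitrary, the criterion also
  covers the complements in \<open>concentrated_on\<close>.\<close>

lemma total_variation_eq_0_iff:
  "total_variation T \<mu> E = 0 \<longleftrightarrow> (\<forall>A\<in>borel_sets T. A \<subseteq> E \<longrightarrow> \<mu> A = 0)"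
proof
  assume 0: "total_variation T \<mu> E = 0"
  show "\<forall>A\<in>borel_sets T. A \<subseteq> E \<longrightarrow> \<mu> A = 0"
  proof (intro ballI impI)
    fix A assume "A \<in> borel_sets T" "A \<subseteq> E"
    then have "ennreal (\<Sum>A\<in>{A}. \<bar>\<mu> A\<bar>) \<le> total_variation T \<mu> E"
      unfolding total_variation_def by (intro SUP_upper) (auto simp: disjoint_def)
    then show "\<mu> A = 0" using 0 by (simp add: ennreal_eq_0_iff)
  qed
next
  assume *: "\<forall>A\<in>borel_sets T. A \<subseteq> E \<longrightarrow> \<mu> A = 0"
  have "(\<Sum>A\<in>P. \<bar>\<mu> A\<bar>) = 0" if "P \<subseteq> borel_sets T" "\<Union>P \<subseteq> E" for P
    using * that by (intro sum.neutral) fastforce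
  then have "total_variation T \<mu> E \<le> 0"
    unfolding total_variation_def by (intro SUP_least) auto
  then show "total_variation T \<mu> E = 0" by simp
qed

lemma total_variation_null_mono:
  "total_variation T \<mu> F = 0 \<Longrightarrow> E \<subseteq> F \<Longrightarrow> total_variation T \<mu> E = 0"
  by (auto simp: total_variation_eq_0_iff)

lemma finite_signed_borel_measure_sums:
  assumes "finite_signed_borel_measure T \<mu>" "\<And>n::nat. A n \<in> borel_sets T" "disjoint_family A"
  shows "(\<lambda>n. \<mu> (A n)) sums \<mu> (\<Union>n. A n)"
  using assms unfolding finite_signed_borel_measure_def by (meson image_subset_iff)

lemma finite_signed_borel_measure_empty:
  assumes "finite_signed_borel_measure T \<mu>"
  shows "\<mu> {} = 0"
proof -
  have "{} \<in> borel_sets T" by (simp add: openin_borel_sets)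
  then have "(\<lambda>n::nat. \<mu> {}) sums \<mu> (\<Union>n::nat. {})"
    by (intro finite_signed_borel_measure_sums[OF assms]) (auto simp: disjoint_family_on_def)
  then show ?thesis
    by (metis sums_summable summable_const_iff)
qed

lemma total_variation_singleton_eq_0:
  assumes "finite_signed_borel_measure T \<mu>" "\<mu> {x} = 0"
  shows "total_variation T \<mu> {x} = 0"
  using assms finite_signed_borel_measure_empty[OF assms(1)]
  unfolding total_variation_eq_0_iff by (metis subset_singletonD)

text \<open>A signed \<open>\<mu>\<close> is not monotone, but a Borel set inside the union is cut
  by the disjointed sequence into Borel subsets of members of \<open>N\<close>, and on each of these
  \<open>\<mu>\<close> vanishes.\<close>

lemma total_variation_null_Union:
  assumes \<mu>: "finite_signed_borel_measure T \<mu>"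
    and N: "countable N" "N \<subseteq> borel_sets T" "\<And>E. E \<in> N \<Longrightarrow> total_variation T \<mu> E = 0"
  shows "total_variation T \<mu> (\<Union>N) = 0"
proof (cases "N = {}")
  case True
  then show ?thesis
    using finite_signed_borel_measure_empty[OF \<mu>] by (auto simp: total_variation_eq_0_iff)
next
  case False
  interpret sigma_algebra "topspace T" "borel_sets T" by (rule sigma_algebra_borel_sets)
  define E where "E = from_nat_into N"
  have E: "range E = N" using False N(1) by (simp add: E_def)
  have dis: "range (disjointed E) \<subseteq> borel_sets T"
    using E N(2) by (intro range_disjointed_sets) auto
  show ?thesis
    unfolding total_variation_eq_0_iff
  proof (intro ballI impI)
    fix A assume A: "A \<in> borel_sets T" "A \<subseteq> \<Union>N"
    have "(\<lambda>n. \<mu> (A \<inter> disjointed E n)) sums \<mu> (\<Union>n. A \<inter> disjointed E n)"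
      proof (rule finite_signed_borel_measure_sums[OF \<mu>])
      show "A \<inter> disjointed E n \<in> borel_sets T" for n using A dis by blast
      show "disjoint_family (\<lambda>n. A \<inter> disjointed E n)"
        using disjoint_family_disjointed[of E] unfolding disjoint_family_on_def by blast
    qed
    moreover have "\<mu> (A \<inter> disjointed E n) = 0" for n
    proof -
      have "total_variation T \<mu> (E n) = 0" using N(3) E by blast
      moreover have "A \<inter> disjointed E n \<subseteq> E n" using disjointed_subset[of E n] by auto
      moreover have "A \<inter> disjointed E n \<in> borel_sets T" using A dis by blast
      ultimately show ?thesis unfolding total_variation_eq_0_iff by blast
    qed
    moreover have "(\<Union>n. A \<inter> disjointed E n) = A"
      using A(2) E by (simp add: UN_disjointed_eq flip: Int_UN_distrib) blast
    ultimately show "\<mu> A = 0"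
      by (metis sums_0 sums_unique2)
  qed
qed

lemma total_variation_null_Un:
  assumes "finite_signed_borel_measure T \<mu>" "A \<in> borel_sets T" "B \<in> borel_sets T"
    and "total_variation T \<mu> A = 0" "total_variation T \<mu> B = 0"
  shows "total_variation T \<mu> (A \<union> B) = 0"
  using total_variation_null_Union[of T \<mu> "{A, B}"] assms by auto

text \<open>Infinitely many points with \<open>\<bar>\<mu> {x}\<bar>\<close> above a fixed positive
  bound would give a disjoint sequence of singletons whose convergent series has terms not tending
  to 0. The bounds \<open>inverse (Suc n)\<close> exhaust all atoms.\<close>

lemma countable_atoms:
  assumes \<mu>: "finite_signed_borel_measure T \<mu>" and T: "t1_space T"
  shows "countable {x \<in> topspace T. \<mu> {x} \<noteq> 0}"
proof -
  have "finite {x \<in> topspace T. \<bar>\<mu> {x}\<bar> > inverse (Suc n)}" (is "finite ?A") for n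
  proof (rule ccontr)
    assume "infinite ?A"
    then obtain f :: "nat \<Rightarrow> 'a" where f: "inj f" "range f \<subseteq> ?A"
      using infinite_countable_subset by blast
    have "{f k} \<in> borel_sets T" for k
      using f(2)[THEN subsetD, OF rangeI, of k] T
      by (intro closedin_borel_sets) (simp add: closedin_t1_singleton)
    then have "(\<lambda>k. \<mu> {f k}) sums \<mu> (\<Union>k. {f k})"
      using f(1) by (intro finite_signed_borel_measure_sums[OF \<mu>]) (auto simp: disjoint_family_on_def inj_def)
    then have "(\<lambda>k. \<mu> {f k}) \<longlonglongrightarrow> 0"
      by (intro summable_LIMSEQ_zero) (auto simp: sums_iff)
    then have "\<forall>\<^sub>F k in sequentially. dist (\<mu> {f k}) 0 < inverse (Suc n)"
      by (rule tendstoD) simp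
    then obtain k where "dist (\<mu> {f k}) 0 < inverse (Suc n)"
      by (auto simp: eventually_sequentially)
    moreover have "\<bar>\<mu> {f k}\<bar> > inverse (Suc n)"
      using f(2) by blast
    ultimately show False by simp
  qed
  then have "countable (\<Union>n. {x \<in> topspace T. \<bar>\<mu> {x}\<bar> > inverse (Suc n)})"
    by (intro countable_UN) (auto intro: countable_finite)
  moreover have "{x \<in> topspace T. \<mu> {x} \<noteq> 0}
      \<subseteq> (\<Union>n. {x \<in> topspace T. \<bar>\<mu> {x}\<bar> > inverse (Suc n)})"
    using reals_Archimedean[of "\<bar>\<mu> {x}\<bar>" for x] by fastforce
  ultimately show ?thesis by (rule countable_subset[rotated])
qed

section \<open>Regularity, local nullity and scattered compact sets\<close>

lemma regular_null:
  assumes "regular_borel_measure T \<mu>" "E \<in> borel_sets T"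
    and "\<And>K. compactin T K \<Longrightarrow> K \<subseteq> E \<Longrightarrow> total_variation T \<mu> K = 0"
  shows "total_variation T \<mu> E = 0"
proof -
  have "total_variation T \<mu> E = (SUP K \<in> {K. compactin T K \<and> K \<subseteq> E}. total_variation T \<mu> K)"
    using assms unfolding regular_borel_measure_def by blast
  also have "\<dots> \<le> 0" using assms(3) by (intro SUP_least) auto
  finally show ?thesis by simp
qed

text \<open>Finitely many of the null neighbourhoods cover \<open>K\<close>. Nullity is asked of the
  traces on \<open>L\<close> because the lemma is applied to the restriction of \<open>\<mu>\<close>
  to \<open>L\<close>, with \<open>K\<close> a compact part of it.\<close>

lemma compactin_locally_null:
  assumes \<mu>: "finite_signed_borel_measure T \<mu>" and K: "compactin T K"
    and loc: "\<And>x. x \<in> K \<Longrightarrow> \<exists>U. openin T U \<and> x \<in> U \<and> U \<inter> L \<in> borel_sets T \<and> total_variation T \<mu> (U \<inter> L) = 0"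
    and "K \<subseteq> L"
  shows "total_variation T \<mu> K = 0"
proof -
  let ?\<U> = "{U. openin T U \<and> U \<inter> L \<in> borel_sets T \<and> total_variation T \<mu> (U \<inter> L) = 0}"
  have "K \<subseteq> \<Union>?\<U>"
  proof
    fix x assume "x \<in> K"
    then obtain U where "x \<in> U" "U \<in> ?\<U>" using loc[of x] by auto
    then show "x \<in> \<Union>?\<U>" by (rule UnionI[rotated])
  qed
  then obtain F where F: "finite F" "F \<subseteq> ?\<U>" "K \<subseteq> \<Union>F"
    using compactinD[OF K, of ?\<U>] by (metis (no_types, lifting) mem_Collect_eq)
  have "total_variation T \<mu> (\<Union>((\<lambda>U. U \<inter> L) ` F)) = 0"
    using F by (intro total_variation_null_Union[OF \<mu>]) (auto intro: countable_finite)
  then show ?thesis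
    by (rule total_variation_null_mono) (use F(3) \<open>K \<subseteq> L\<close> in blast)
qed

lemma scattered_compactin_null:
  assumes \<mu>: "\<mu> \<in> signed_regular_borel_measures T" and T: "Hausdorff_space T"
    and K: "compactin T K" "scattered_space (subtopology T K)"
    and L: "compactin T L" "L \<subseteq> K" and atomless: "\<And>x. x \<in> L \<Longrightarrow> \<mu> {x} = 0"
  shows "total_variation T \<mu> L = 0"
proof -
  have fsm: "finite_signed_borel_measure T \<mu>" and reg: "regular_borel_measure T \<mu>"
    using \<mu> by (auto simp: signed_regular_borel_measures_def)
  interpret sigma_algebra "topspace T" "borel_sets T" by (rule sigma_algebra_borel_sets)
  have Lb: "L \<in> borel_sets T"
    using L T by (intro closedin_borel_sets compactin_imp_closedin)
  let ?null = "\<lambda>U. openin T U \<and> total_variation T \<mu> (U \<inter> L) = 0"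
  have bo: "U \<inter> L \<in> borel_sets T" if "openin T U" for U
    using Int[OF openin_borel_sets[OF that] Lb] .
  \<comment> \<open>The support of the restriction of \<open>\<mu>\<close> to \<open>L\<close>; at an isolated point of it the measure
    would have an atom.\<close>
  define F where "F = {x \<in> L. \<forall>U. x \<in> U \<longrightarrow> \<not> ?null U}"
  have "F = {}"
  proof (rule ccontr)
    assume "F \<noteq> {}"
    moreover have FL: "F \<subseteq> L" by (auto simp: F_def)
    moreover have "K \<subseteq> topspace T" using K(1) compactin_subset_topspace by blast
    ultimately obtain x where x: "x \<in> F" "openin (subtopology (subtopology T K) F) {x}"
      using K(2) L(2) unfolding scattered_space_def by (metis Int_absorb1 order_trans topspace_subtopology)
    have "openin (subtopology T F) {x}"
      using x(2) FL L(2) by (metis Int_absorb1 order_trans subtopology_subtopology)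
    then obtain U where U: "openin T U" "U \<inter> F = {x}"
      by (auto simp: openin_subtopology)
    have xL: "x \<in> L" using x FL by blast
    have xb: "{x} \<in> borel_sets T"
      using xL compactin_subset_topspace[OF L(1)] Hausdorff_imp_t1_space[OF T]
      by (intro closedin_borel_sets) (auto simp: closedin_t1_singleton)
    \<comment> \<open>All points of \<open>U \<inter> L\<close> other than \<open>x\<close> lie
      outside \<open>F\<close>, so compact subsets are locally null; inner regularity extends this
      to the difference, which need not be compact.\<close>
    have "total_variation T \<mu> (U \<inter> L - {x}) = 0"
    proof (rule regular_null[OF reg])
      show "U \<inter> L - {x} \<in> borel_sets T" using bo U(1) xb by blast
      fix M assume M: "compactin T M" "M \<subseteq> U \<inter> L - {x}"
      show "total_variation T \<mu> M = 0"
      proof (rule compactin_locally_null[OF fsm M(1)])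
        show "M \<subseteq> L" using M by auto
        fix y assume "y \<in> M"
        then have "y \<in> L" "y \<notin> F" using M U by auto
        then show "\<exists>U. openin T U \<and> y \<in> U \<and> U \<inter> L \<in> borel_sets T \<and> total_variation T \<mu> (U \<inter> L) = 0"
          using bo by (auto simp: F_def)
      qed
    qed
    \<comment> \<open>Putting back \<open>x\<close>, which is no atom, makes \<open>U\<close> a null
      neighbourhood of a point of \<open>F\<close>.\<close>
    then have "total_variation T \<mu> ((U \<inter> L - {x}) \<union> {x}) = 0"
      using bo[OF U(1)] xb atomless[OF xL]
      by (intro total_variation_null_Un[OF fsm] total_variation_singleton_eq_0[OF fsm]) auto
    then have "total_variation T \<mu> (U \<inter> L) = 0"
      by (rule total_variation_null_mono) auto
    then show False using x(1) U by (auto simp: F_def)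
  qed
  show ?thesis
  proof (rule compactin_locally_null[OF fsm L(1) _ order_refl])
    fix x assume "x \<in> L"
    then obtain U where "x \<in> U" "?null U" using \<open>F = {}\<close> unfolding F_def by blast
    then show "\<exists>U. openin T U \<and> x \<in> U \<and> U \<inter> L \<in> borel_sets T \<and> total_variation T \<mu> (U \<inter> L) = 0"
      using bo by blast
  qed
qed

section \<open>Scattered spaces\<close>

lemma scattered_space_homeomorphic_map:
  assumes f: "homeomorphic_map X Y f" and X: "scattered_space X"
  shows "scattered_space Y"
  unfolding scattered_space_def
proof (intro allI impI)
  fix S assume S: "S \<subseteq> topspace Y \<and> S \<noteq> {}"
  define R where "R = {x \<in> topspace X. f x \<in> S}"
  have "f ` topspace X = topspace Y"
    by (rule homeomorphic_imp_surjective_map[OF f])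
  moreover have "f ` R = f ` topspace X \<inter> S" by (auto simp: R_def)
  ultimately have RS: "f ` R = S" using S by (simp add: Int_absorb1)
  have R: "R \<subseteq> topspace X" "R \<noteq> {}" using RS S by (force simp: R_def)+
  then obtain x where x: "x \<in> R" "openin (subtopology X R) {x}"
    using X unfolding scattered_space_def by blast
  have "homeomorphic_map (subtopology X R) (subtopology Y S) f"
    by (rule homeomorphic_map_subtopologies[OF f])
      (use RS R S in \<open>simp only: Int_absorb1\<close>)
  then have "openin (subtopology Y S) (f ` {x})"
    using x R by (metis homeomorphic_map_openness_eq)
  then show "\<exists>y\<in>S. openin (subtopology Y S) {y}"
    using x RS by auto
qed

lemma scattered_space_homeomorphic_map_iff:
  assumes "homeomorphic_map X Y f"
  shows "scattered_space X \<longleftrightarrow> scattered_space Y"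
proof -
  obtain g where "homeomorphic_maps X Y f g"
    using assms by (auto simp: homeomorphic_map_maps)
  then have "homeomorphic_map Y X g"
    by (auto simp: homeomorphic_maps_map)
  then show ?thesis
    using scattered_space_homeomorphic_map[OF assms] scattered_space_homeomorphic_map by blast
qed

lemma scattered_space_embedding_map:
  assumes f: "embedding_map X Y f" and K: "K \<subseteq> topspace X"
  shows "scattered_space (subtopology Y (f ` K)) \<longleftrightarrow> scattered_space (subtopology X K)"
proof -
  have h: "homeomorphic_map X (subtopology Y (f ` topspace X)) f"
    using f by (simp add: embedding_map_def)
  have "homeomorphic_map (subtopology X K) (subtopology (subtopology Y (f ` topspace X)) (f ` K)) f"
  proof (rule homeomorphic_map_subtopologies[OF h])
    have "topspace (subtopology Y (f ` topspace X)) \<inter> f ` K = f ` topspace X \<inter> f ` K"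
      using homeomorphic_imp_surjective_map[OF h] by metis
    then show "f ` (topspace X \<inter> K) = topspace (subtopology Y (f ` topspace X)) \<inter> f ` K"
      using K by (simp only: Int_absorb1 image_mono)
  qed
  moreover have "subtopology (subtopology Y (f ` topspace X)) (f ` K) = subtopology Y (f ` K)"
    using K by (simp add: subtopology_subtopology image_mono Int_absorb1)
  ultimately show ?thesis
    using scattered_space_homeomorphic_map_iff by fastforce
qed

section \<open>Regular measures from finitely additive ones\<close>

text \<open>Disjoint open sets around \<open>C - U\<close> and \<open>C - V\<close> are removed from
  \<open>C\<close> in turn; the remainders lie in \<open>U\<close> and in \<open>V\<close>, and by
  disjointness no point is removed both times. This makes the closed inner approximation
  subadditive.\<close>

lemma normal_space_closedin_split:
  assumes T: "normal_space T" and C: "closedin T C" "C \<subseteq> U \<union> V" and U: "openin T U" and V: "openin T V"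
  obtains A B where "closedin T A" "closedin T B" "A \<subseteq> U" "B \<subseteq> V" "C = A \<union> B"
proof -
  have "closedin T (C - U)" "closedin T (C - V)" "disjnt (C - U) (C - V)"
    using C U V by (auto simp: disjnt_iff intro: closedin_diff)
  then obtain P Q where PQ: "openin T P" "openin T Q" "C - U \<subseteq> P" "C - V \<subseteq> Q" "disjnt P Q"
    using T unfolding normal_space_def by meson
  show thesis
  proof (rule that)
    show "closedin T (C - P)" "closedin T (C - Q)"
      using C PQ by (auto intro: closedin_diff)
    show "C - P \<subseteq> U" "C - Q \<subseteq> V" using PQ by auto
    show "C = (C - P) \<union> (C - Q)" using PQ(5) by (auto simp: disjnt_iff)
  qed
qed

text \<open>Additivity is stated for all sets, Borel or not: a pointwise limit of finitely supported
  distributions keeps it, while countable additivity can be lost.\<close>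

locale additive_content =
  fixes T :: "'b topology" and m :: "'b set \<Rightarrow> real"
  assumes compact: "compact_space T" and Hausdorff: "Hausdorff_space T"
    and nonneg: "\<And>A. 0 \<le> m A"
    and additive: "\<And>A B. A \<inter> B = {} \<Longrightarrow> m (A \<union> B) = m A + m B"
begin

lemma empty: "m {} = 0"
  using additive[of "{}" "{}"] by simp

lemma mono: "A \<subseteq> B \<Longrightarrow> m A \<le> m B"
  using additive[of A "B - A"] nonneg[of "B - A"] by (simp add: Un_absorb1)

lemma subadditive: "m (A \<union> B) \<le> m A + m B"
  using additive[of A "B - A"] mono[of "B - A" B] by simp

lemma normal: "normal_space T"
  using compact Hausdorff compact_Hausdorff_or_regular_imp_normal_space by blast

text \<open>
  On open sets \<open>m\<close> itself may fail to be countably subadditive; its inner approximation by closed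
  sets is, by compactness.
\<close>

definition open_content :: "'b set \<Rightarrow> ennreal" where
  "open_content U = (SUP C \<in> {C. closedin T C \<and> C \<subseteq> U}. ennreal (m C))"

text \<open>Taking the infimum over open supersets makes outer regularity of the resulting measure
  hold by construction.\<close>

definition outer :: "'b set \<Rightarrow> ennreal" where
  "outer E = (INF U \<in> {U. openin T U \<and> E \<subseteq> U}. open_content U)"

lemma le_open_content: "closedin T C \<Longrightarrow> C \<subseteq> U \<Longrightarrow> ennreal (m C) \<le> open_content U"
  unfolding open_content_def by (rule SUP_upper) simp

lemma open_content_le: "open_content U \<le> ennreal (m U)"
  unfolding open_content_def by (intro SUP_least ennreal_leI mono) simp

lemma open_content_mono: "U \<subseteq> V \<Longrightarrow> open_content U \<le> open_content V"
  unfolding open_content_def by (intro SUP_subset_mono) auto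

lemma outer_le_open_content: "openin T U \<Longrightarrow> E \<subseteq> U \<Longrightarrow> outer E \<le> open_content U"
  unfolding outer_def by (rule INF_lower) simp

lemma outer_open: "openin T U \<Longrightarrow> outer U = open_content U"
  by (intro antisym outer_le_open_content order_refl)
     (auto simp: outer_def intro!: INF_greatest open_content_mono)

lemma outer_mono: "E \<subseteq> F \<Longrightarrow> outer E \<le> outer F"
  unfolding outer_def by (intro INF_superset_mono) auto

text \<open>Together with \<open>outer_topspace_le\<close> this later fixes the mass: a closed set
  of content 1 gets mass at least 1, and the whole space at most
  \<open>m (topspace T)\<close>.\<close>

lemma le_outer: "closedin T C \<Longrightarrow> ennreal (m C) \<le> outer C"
  unfolding outer_def by (intro INF_greatest le_open_content) auto

lemma outer_topspace_le: "outer (topspace T) \<le> ennreal (m (topspace T))"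
  by (simp add: outer_open open_content_le)

lemma outer_finite: "E \<subseteq> topspace T \<Longrightarrow> outer E < top"
  using outer_mono[of E "topspace T"] outer_topspace_le ennreal_less_top
  by (metis order_le_less_trans)

section \<open>Subadditivity and Caratheodory measurability of open sets\<close>

lemma open_content_Un:
  assumes "openin T U" "openin T V"
  shows "open_content (U \<union> V) \<le> open_content U + open_content V"
proof -
  have "ennreal (m C) \<le> open_content U + open_content V" if C: "closedin T C" "C \<subseteq> U \<union> V" for C
  proof -
    obtain A B where AB: "closedin T A" "closedin T B" "A \<subseteq> U" "B \<subseteq> V" "C = A \<union> B"
      using normal_space_closedin_split[OF normal C assms] .
    have "ennreal (m C) \<le> ennreal (m A) + ennreal (m B)"
      using subadditive[of A B] AB(5) nonneg by (simp flip: ennreal_plus)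
    also have "\<dots> \<le> open_content U + open_content V"
      using AB by (intro add_mono le_open_content)
    finally show ?thesis .
  qed
  then show ?thesis
    unfolding open_content_def[of "U \<union> V"] by (intro SUP_least) simp
qed

lemma open_content_UN_lessThan:
  fixes U :: "nat \<Rightarrow> 'b set"
  assumes "\<And>i. openin T (U i)"
  shows "open_content (\<Union>i<n. U i) \<le> (\<Sum>i<n. open_content (U i))"
proof (induction n)
  case 0
  show ?case using open_content_le[of "{}"] by (simp add: empty)
next
  case (Suc n)
  have "open_content (\<Union>i<Suc n. U i) = open_content ((\<Union>i<n. U i) \<union> U n)"
    by (simp add: lessThan_Suc Un_commute)
  also have "\<dots> \<le> open_content (\<Union>i<n. U i) + open_content (U n)"
    using assms by (intro open_content_Un) auto
  also have "\<dots> \<le> (\<Sum>i<Suc n. open_content (U i))"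
    using Suc by (simp add: add_right_mono)
  finally show ?case .
qed

text \<open>A closed, hence compact, subset of the union lies in finitely many \<open>U i\<close>,
  so the finite case bounds its content; then the supremum is taken.\<close>

lemma open_content_UN:
  fixes U :: "nat \<Rightarrow> 'b set"
  assumes U: "\<And>i. openin T (U i)"
  shows "open_content (\<Union>i. U i) \<le> (\<Sum>i. open_content (U i))"
proof -
  have "ennreal (m C) \<le> (\<Sum>i. open_content (U i))" if C: "closedin T C" "C \<subseteq> (\<Union>i. U i)" for C
  proof -
    have "compactin T C"
      using C compact closedin_compact_space by blast
    then obtain F where F: "finite F" "F \<subseteq> range U" "C \<subseteq> \<Union>F"
      using compactinD[of T C "range U"] U C by (metis rangeE)
    then obtain I where I: "finite I" "F = U ` I"
      by (metis finite_subset_image)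
    then obtain n where "I \<subseteq> {..<n}"
      using finite_nat_iff_bounded by auto
    then have "C \<subseteq> (\<Union>i<n. U i)"
      using F(3) I(2) by blast
    then have "ennreal (m C) \<le> open_content (\<Union>i<n. U i)"
      by (intro le_open_content C)
    also have "\<dots> \<le> (\<Sum>i<n. open_content (U i))"
      by (intro open_content_UN_lessThan U)
    also have "\<dots> \<le> (\<Sum>i. open_content (U i))"
      by (intro sum_le_suminf) auto
    finally show ?thesis .
  qed
  then show ?thesis
    unfolding open_content_def[of "\<Union>i. U i"] by (intro SUP_least) simp
qed

lemma outer_approx:
  assumes "E \<subseteq> topspace T" "0 < e"
  obtains U where "openin T U" "E \<subseteq> U" "open_content U \<le> outer E + ennreal e"
proof -
  have "outer E < outer E + ennreal e"
    using outer_finite[OF assms(1)] assms(2) by simp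
  then obtain U where "openin T U" "E \<subseteq> U" "open_content U < outer E + ennreal e"
    unfolding outer_def INF_less_iff by auto
  then show thesis by (intro that) auto
qed

lemma outer_UN_le:
  fixes A :: "nat \<Rightarrow> 'b set"
  assumes A: "\<And>i. A i \<subseteq> topspace T"
  shows "outer (\<Union>i. A i) \<le> (\<Sum>i. outer (A i))"
proof (rule ennreal_le_epsilon)
  fix e :: real assume e: "0 < e"
  \<comment> \<open>The allowances \<open>e * (1/2) ^ Suc i\<close> start at \<open>e / 2\<close>
    and so add up to exactly \<open>e\<close>.\<close>
  have "\<forall>i. \<exists>U. openin T U \<and> A i \<subseteq> U \<and> open_content U \<le> outer (A i) + ennreal (e * (1/2) ^ Suc i)"
    using outer_approx[OF A] e by (metis mult_pos_pos zero_less_power half_gt_zero_iff zero_less_one)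
  then obtain U where U: "\<And>i. openin T (U i)" "\<And>i. A i \<subseteq> U i"
    "\<And>i. open_content (U i) \<le> outer (A i) + ennreal (e * (1/2) ^ Suc i)"
    by metis
  have "outer (\<Union>i. A i) \<le> open_content (\<Union>i. U i)"
    by (intro outer_le_open_content openin_Union UN_mono) (use U in auto)
  also have "\<dots> \<le> (\<Sum>i. open_content (U i))"
    by (rule open_content_UN[OF U(1)])
  also have "\<dots> \<le> (\<Sum>i. outer (A i) + ennreal (e * (1/2) ^ Suc i))"
    by (intro suminf_le U(3)) auto
  also have "\<dots> = (\<Sum>i. outer (A i)) + (\<Sum>i. ennreal e * ennreal ((1/2) ^ Suc i))"
    using e by (subst suminf_add[symmetric])
      (auto simp del: ennreal_suminf_cmult simp add: ennreal_mult[symmetric])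
  also have "\<dots> = (\<Sum>i. outer (A i)) + ennreal e"
    unfolding ennreal_suminf_cmult
    by (subst suminf_ennreal_eq[OF zero_le_power power_half_series]) auto
  finally show "outer (\<Union>i. A i) \<le> (\<Sum>i. outer (A i)) + ennreal e" .
qed

lemma outer_measure_space_outer: "outer_measure_space (Pow (topspace T)) outer"
  unfolding outer_measure_space_def
proof (intro conjI)
  show "positive (Pow (topspace T)) outer"
    using outer_open[of "{}"] open_content_le[of "{}"] by (simp add: positive_def empty)
  show "increasing (Pow (topspace T)) outer"
    by (simp add: increasing_def outer_mono)
  show "countably_subadditive (Pow (topspace T)) outer"
    unfolding countably_subadditive_def by (intro allI impI outer_UN_le) auto
qed

text \<open>Measurability is first tested on open \<open>W\<close>. For closed \<open>C\<close> in
  \<open>W \<inter> U\<close>, the set \<open>W - C\<close> is open and contains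
  \<open>W - U\<close>; closed sets \<open>D\<close> in it are disjoint from \<open>C\<close>, so
  \<open>m C + m D = m (C \<union> D)\<close>. Suprema over \<open>D\<close> and then over
  \<open>C\<close> give \<open>open_le\<close>; the infimum over \<open>W\<close> gives all test
  sets.\<close>

lemma openin_lambda_system:
  assumes U: "openin T U"
  shows "U \<in> lambda_system (topspace T) (Pow (topspace T)) outer"
proof -
  interpret Pow: sigma_algebra "topspace T" "Pow (topspace T)" by (rule sigma_algebra_Pow)
  have oms: "positive (Pow (topspace T)) outer" "countably_subadditive (Pow (topspace T)) outer"
    using outer_measure_space_outer by (auto simp: outer_measure_space_def)
  have sub: "subadditive (Pow (topspace T)) outer"
    by (rule Pow.countably_subadditive_subadditive[OF oms])
  have open_le: "open_content (W \<inter> U) + outer (W - U) \<le> open_content W" if W: "openin T W" for W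
  proof -
    have "ennreal (m C) + outer (W - U) \<le> open_content W" if C: "closedin T C" "C \<subseteq> W \<inter> U" for C
    proof -
      have "outer (W - U) \<le> open_content (W - C)"
        using C W by (intro outer_le_open_content openin_diff) auto
      then have "ennreal (m C) + outer (W - U) \<le> ennreal (m C) + open_content (W - C)"
        by (rule add_left_mono)
      \<comment> \<open>The empty set keeps the index set nonempty, so the constant can move inside
        the supremum.\<close>
      also have "\<dots> = (SUP D \<in> {D. closedin T D \<and> D \<subseteq> W - C}. ennreal (m C) + ennreal (m D))"
        unfolding open_content_def[of "W - C"]
        by (subst ennreal_SUP_add_right) (auto intro: exI[of _ "{}"])
      also have "\<dots> \<le> open_content W"
      proof (rule SUP_least)
        fix D assume D: "D \<in> {D. closedin T D \<and> D \<subseteq> W - C}"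
        then have "C \<inter> D = {}" by auto
        then have "ennreal (m C) + ennreal (m D) = ennreal (m (C \<union> D))"
          using additive[of C D] nonneg by simp
        also have "\<dots> \<le> open_content W"
          using C D by (intro le_open_content closedin_Un) auto
        finally show "ennreal (m C) + ennreal (m D) \<le> open_content W" .
      qed
      finally show ?thesis .
    qed
    then have "(SUP C \<in> {C. closedin T C \<and> C \<subseteq> W \<inter> U}. ennreal (m C) + outer (W - U)) \<le> open_content W"
      by (intro SUP_least) simp
    moreover have "(SUP C \<in> {C. closedin T C \<and> C \<subseteq> W \<inter> U}. ennreal (m C) + outer (W - U))
        = open_content (W \<inter> U) + outer (W - U)"
      unfolding open_content_def by (intro ennreal_SUP_add_left) (auto intro: exI[of _ "{}"])
    ultimately show ?thesis by simp
  qed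
  have "outer (E \<inter> U) + outer (E - U) = outer E" if E: "E \<subseteq> topspace T" for E
  proof (rule antisym)
    show "outer (E \<inter> U) + outer (E - U) \<le> outer E"
      unfolding outer_def[of E]
    proof (rule INF_greatest)
      fix W assume W: "W \<in> {W. openin T W \<and> E \<subseteq> W}"
      have "outer (E \<inter> U) + outer (E - U) \<le> open_content (W \<inter> U) + outer (W - U)"
        using W U by (intro add_mono outer_le_open_content outer_mono) auto
      also have "\<dots> \<le> open_content W" using W by (intro open_le) simp
      finally show "outer (E \<inter> U) + outer (E - U) \<le> open_content W" .
    qed
    have "outer ((E \<inter> U) \<union> (E - U)) \<le> outer (E \<inter> U) + outer (E - U)"
      using E by (intro subadditiveD[OF sub]) auto
    moreover have "(E \<inter> U) \<union> (E - U) = E" by auto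
    ultimately show "outer E \<le> outer (E \<inter> U) + outer (E - U)" by simp
  qed
  then show ?thesis
    unfolding Pow.lambda_system_eq using openin_subset[OF U] by simp
qed

section \<open>The Borel measure and its regularity\<close>

definition content_measure :: "'b measure" where
  "content_measure = measure_of (topspace T) (borel_sets T) outer"

lemma space_content_measure: "space content_measure = topspace T"
  and sets_content_measure: "sets content_measure = borel_sets T"
  unfolding content_measure_def
  by (rule sigma_algebra.space_measure_of_eq[OF sigma_algebra_borel_sets]
      sigma_algebra.sets_measure_of_eq[OF sigma_algebra_borel_sets])+

text \<open>By Caratheodory's lemma the measurable sets form a sigma-algebra on which
  \<open>outer\<close> is a measure; containing the open sets, it contains all Borel sets.\<close>

lemma emeasure_content_measure:
  assumes "E \<in> borel_sets T"
  shows "emeasure content_measure E = outer E"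
proof -
  let ?L = "lambda_system (topspace T) (Pow (topspace T)) outer"
  have L: "measure_space (topspace T) ?L outer"
    by (rule sigma_algebra.caratheodory_lemma[OF sigma_algebra_Pow outer_measure_space_outer])
  then have "sigma_sets (topspace T) {U. openin T U} \<subseteq> ?L"
    by (intro sigma_algebra.sigma_sets_subset)
       (auto simp: measure_space_def intro: openin_lambda_system)
  then have sub: "borel_sets T \<subseteq> ?L" by (simp add: borel_sets_def)
  have "measure_space (topspace T) (borel_sets T) outer"
    by (rule measure_down[OF L sigma_algebra_borel_sets sub])
  then show ?thesis
    unfolding content_measure_def using assms
    by (intro emeasure_measure_of_sigma) (auto simp: measure_space_def)
qed

lemma finite_measure_content_measure: "finite_measure content_measure"
proof
  have "topspace T \<in> borel_sets T" by (simp add: openin_borel_sets)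
  then show "emeasure content_measure (space content_measure) \<noteq> \<infinity>"
    using outer_finite[OF order_refl] by (simp add: space_content_measure emeasure_content_measure)
qed

lemma outer_regular_content_measure:
  assumes "E \<in> borel_sets T"
  shows "emeasure content_measure E
    = (INF U \<in> {U. openin T U \<and> E \<subseteq> U}. emeasure content_measure U)"
  using assms by (simp add: emeasure_content_measure openin_borel_sets outer_def[of E] outer_open)

end

text \<open>Outer regularity is applied to the complement of \<open>E\<close>: an open
  \<open>U\<close> around it has a closed, hence compact, complement \<open>K\<close>, and
  \<open>E - K\<close> has exactly the measure by which \<open>U\<close> exceeds the complement of
  \<open>E\<close>. Finiteness permits the subtractions.\<close>

lemma inner_regularI:
  assumes fin: "finite_measure N" and sets: "sets N = borel_sets T" and sp: "space N = topspace T"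
    and T: "compact_space T"
    and outer: "\<And>E. E \<in> borel_sets T \<Longrightarrow>
      emeasure N E = (INF U \<in> {U. openin T U \<and> E \<subseteq> U}. emeasure N U)"
    and E: "E \<in> borel_sets T"
  shows "emeasure N E = (SUP K \<in> {K. compactin T K \<and> K \<subseteq> E}. emeasure N K)"
proof (rule antisym)
  interpret N: finite_measure N by fact
  have EN: "E \<in> sets N" using E sets by simp
  have Es: "E \<subseteq> topspace T" using sets.sets_into_space[OF EN] sp by simp
  show "(SUP K \<in> {K. compactin T K \<and> K \<subseteq> E}. emeasure N K) \<le> emeasure N E"
    by (intro SUP_least emeasure_mono EN) simp
  show "emeasure N E \<le> (SUP K \<in> {K. compactin T K \<and> K \<subseteq> E}. emeasure N K)" (is "_ \<le> ?S")
  proof (rule ennreal_le_epsilon)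
    fix e :: real assume e: "0 < e"
    let ?F = "topspace T - E"
    have F: "?F \<in> sets N" using sets.compl_sets[OF EN] sp by simp
    have "emeasure N ?F < emeasure N ?F + ennreal e"
      using e N.emeasure_finite[of ?F] by (simp add: less_top)
    moreover have "emeasure N ?F = (INF U \<in> {U. openin T U \<and> ?F \<subseteq> U}. emeasure N U)"
      using F sets by (intro outer) simp
    ultimately have "(INF U \<in> {U. openin T U \<and> ?F \<subseteq> U}. emeasure N U) < emeasure N ?F + ennreal e"
      by simp
    then obtain U where U: "openin T U" "?F \<subseteq> U" "emeasure N U < emeasure N ?F + ennreal e"
      unfolding INF_less_iff by auto
    have UN: "U \<in> sets N" using U(1) sets openin_borel_sets by blast
    define K where "K = topspace T - U"
    have K: "closedin T K" "K \<subseteq> E" using U Es by (auto simp: K_def)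
    then have Kc: "compactin T K" using T closedin_compact_space by blast
    have KN: "K \<in> sets N" using K(1) closedin_borel_sets sets by blast
    have Us: "U \<subseteq> topspace T" by (rule openin_subset[OF U(1)])
    have "measure N U = measure N ?F + measure N (E - K)"
    proof -
      have "U = ?F \<union> (E - K)" using U(2) Us Es by (auto simp: K_def)
      moreover have "?F \<inter> (E - K) = {}" by auto
      ultimately show ?thesis
        using N.finite_measure_Union[OF F, of "E - K"] EN KN by simp
    qed
    moreover have "measure N (E - K) = measure N E - measure N K"
      by (rule N.finite_measure_Diff[OF EN KN K(2)])
    moreover have "measure N U < measure N ?F + e"
      using U(3) e by (simp add: N.emeasure_eq_measure ennreal_less_iff flip: ennreal_plus)
    ultimately have "measure N E \<le> measure N K + e" by simp
    then have "emeasure N E \<le> emeasure N K + ennreal e"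
      using e by (simp add: N.emeasure_eq_measure flip: ennreal_plus)
    also have "\<dots> \<le> ?S + ennreal e"
      using Kc K(2) by (intro add_right_mono SUP_upper) simp
    finally show "emeasure N E \<le> ?S + ennreal e" .
  qed
qed

text \<open>For a positive measure, additivity and monotonicity bound the sum over every family by
  the value at \<open>E\<close>, and the family \<open>{E}\<close> attains it. The
  \<open>restrict\<close> gives the extensional form required of signed measures.\<close>

lemma total_variation_measure:
  assumes fin: "finite_measure N" and sets: "sets N = borel_sets T" and E: "E \<in> borel_sets T"
  shows "total_variation T (restrict (measure N) (borel_sets T)) E = emeasure N E"
proof (rule antisym)
  interpret N: finite_measure N by fact
  let ?\<mu> = "restrict (measure N) (borel_sets T)"
  have "ennreal (\<Sum>A\<in>P. \<bar>?\<mu> A\<bar>) \<le> emeasure N E"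
    if P: "finite P" "P \<subseteq> borel_sets T" "disjoint P" "\<Union>P \<subseteq> E" for P
  proof -
    have "(\<Sum>A\<in>P. \<bar>?\<mu> A\<bar>) = (\<Sum>A\<in>P. measure N A)"
      using P(2) by (intro sum.cong) auto
    also have "\<dots> = measure N (\<Union>P)"
      using N.finite_measure_finite_Union[OF P(1), of "\<lambda>A. A"] P sets
      by (simp add: disjoint_family_on_def disjoint_def)
    also have "\<dots> \<le> measure N E"
      using P(4) E sets by (intro N.finite_measure_mono) auto
    finally show ?thesis
      by (simp add: N.emeasure_eq_measure ennreal_leI)
  qed
  then show "total_variation T ?\<mu> E \<le> emeasure N E"
    unfolding total_variation_def by (intro SUP_least) auto
  have "ennreal (\<Sum>A\<in>{E}. \<bar>?\<mu> A\<bar>) \<le> total_variation T ?\<mu> E"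
    unfolding total_variation_def using E by (intro SUP_upper) (auto simp: disjoint_def)
  then show "emeasure N E \<le> total_variation T ?\<mu> E"
    using E by (simp add: N.emeasure_eq_measure)
qed

lemma restrict_measure_signed_regular:
  assumes fin: "finite_measure N" and sets: "sets N = borel_sets T" and sp: "space N = topspace T"
    and T: "compact_space T" "Hausdorff_space T"
    and outer: "\<And>E. E \<in> borel_sets T \<Longrightarrow>
      emeasure N E = (INF U \<in> {U. openin T U \<and> E \<subseteq> U}. emeasure N U)"
  shows "restrict (measure N) (borel_sets T) \<in> signed_regular_borel_measures T"
    (is "?\<mu> \<in> _")
proof -
  interpret N: finite_measure N by fact
  note tv = total_variation_measure[OF fin sets]
  have "finite_signed_borel_measure T ?\<mu>"
    unfolding finite_signed_borel_measure_def
  proof (intro conjI allI impI)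
    fix A :: "nat \<Rightarrow> 'a set" assume A: "range A \<subseteq> borel_sets T \<and> disjoint_family A"
    have "A n \<in> borel_sets T" for n using A by auto
    moreover have "(\<Union>n. A n) \<in> sets N" using A sets by blast
    moreover have "(\<lambda>n. measure N (A n)) sums measure N (\<Union>n. A n)"
      using A sets by (intro N.finite_measure_UNION) auto
    ultimately show "(\<lambda>n. ?\<mu> (A n)) sums ?\<mu> (\<Union>n. A n)"
      using sets by simp
  qed simp
  moreover have "regular_borel_measure T ?\<mu>"
    unfolding regular_borel_measure_def
  proof (intro ballI conjI)
    fix E assume E: "E \<in> borel_sets T"
    show "total_variation T ?\<mu> E = (INF U \<in> {U. openin T U \<and> E \<subseteq> U}. total_variation T ?\<mu> U)"
      using outer[OF E] by (simp add: tv E openin_borel_sets)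
    have "compactin T K \<Longrightarrow> K \<in> borel_sets T" for K
      using T(2) by (intro closedin_borel_sets compactin_imp_closedin)
    then show "total_variation T ?\<mu> E = (SUP K \<in> {K. compactin T K \<and> K \<subseteq> E}. total_variation T ?\<mu> K)"
      using inner_regularI[OF fin sets sp T(1) outer E] by (simp add: tv E)
  qed
  ultimately show ?thesis by (simp add: signed_regular_borel_measures_def)
qed

section \<open>Atomless measures on non-scattered spaces\<close>

text \<open>Tychonoff for a cube over an arbitrary, possibly uncountable index type. A subsequence
  need not converge there, so the limit is taken along a filter finer than
  \<open>sequentially\<close>, which keeps every eventual bound.\<close>

lemma pointwise_cluster:
  fixes f :: "nat \<Rightarrow> 'c \<Rightarrow> real"
  assumes f: "\<And>n E. f n E \<in> {0..1}"
  obtains F m where "F \<noteq> bot" "F \<le> sequentially" "\<And>E. ((\<lambda>n. f n E) \<longlongrightarrow> m E) F"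
proof -
  let ?C = "PiE UNIV (\<lambda>_::'c. {0..1::real})"
  have "compactin (product_topology (\<lambda>_::'c. euclidean :: real topology) UNIV) ?C"
    unfolding compactin_PiE by simp
  then have "compact ?C"
    by (simp add: euclidean_product_topology)
  moreover have "filtermap f sequentially \<noteq> bot" by (simp add: filtermap_bot_iff)
  moreover have "eventually (\<lambda>g. g \<in> ?C) (filtermap f sequentially)"
    using f by (simp add: eventually_filtermap PiE_UNIV_domain)
  ultimately obtain m where m: "inf (nhds m) (filtermap f sequentially) \<noteq> bot"
    unfolding compact_filter by blast
  \<comment> \<open>Generated by the tails and the preimages of neighbourhoods of the cluster point
    \<open>m\<close>; were it trivial, some neighbourhood of \<open>m\<close> would be avoided from
    some index on.\<close>
  define F where "F = inf sequentially (filtercomap f (nhds m))"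
  have "F \<noteq> bot"
  proof
    assume "F = bot"
    then have "eventually (\<lambda>_. False) F" by simp
    then obtain Q R where Q: "eventually Q sequentially" and R: "eventually R (filtercomap f (nhds m))"
      and QR: "\<And>n. Q n \<Longrightarrow> R n \<Longrightarrow> False"
      unfolding F_def eventually_inf by blast
    obtain P where P: "eventually P (nhds m)" "\<And>n. P (f n) \<Longrightarrow> R n"
      using R unfolding eventually_filtercomap by blast
    have "eventually (\<lambda>n. \<not> P (f n)) sequentially"
      using Q by (rule eventually_mono) (use QR P(2) in blast)
    then have "eventually (\<lambda>g. \<not> P g) (filtermap f sequentially)"
      by (simp add: eventually_filtermap)
    then have "eventually (\<lambda>_. False) (inf (nhds m) (filtermap f sequentially))"
      unfolding eventually_inf using P(1) by blast
    then show False using m by (simp add: trivial_limit_def)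
  qed
  moreover have "F \<le> sequentially" by (simp add: F_def)
  moreover have "((\<lambda>n. f n E) \<longlongrightarrow> m E) F" for E
  proof -
    have lim: "filterlim f (nhds m) F"
      unfolding F_def by (rule filterlim_mono[OF filterlim_filtercomap order_refl inf_le2])
    show ?thesis
    proof (rule topological_tendstoI)
      fix B :: "real set" assume B: "open B" "m E \<in> B"
      have "open ((\<lambda>g. g E) -` B)"
        by (rule open_vimage[OF B(1) continuous_on_product_coordinates])
      then have "eventually (\<lambda>g. g \<in> (\<lambda>g. g E) -` B) (nhds m)"
        using B(2) by (intro eventually_nhds_in_open) simp_all
      then show "eventually (\<lambda>n. f n E \<in> B) F"
        using lim by (auto dest: filterlim_cong simp: filterlim_iff)
    qed
  qed
  ultimately show thesis by (rule that)
qed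

text \<open>Since \<open>S\<close> has no isolated point, \<open>W\<close> contains two points of
  it. They have disjoint neighbourhoods, and normality fits the closures of smaller neighbourhoods
  into these and into \<open>W\<close>.\<close>

lemma dense_in_itself_split:
  assumes T: "normal_space T" "Hausdorff_space T"
    and S: "S \<subseteq> topspace T" "\<And>x. x \<in> S \<Longrightarrow> \<not> openin (subtopology T S) {x}"
    and W: "openin T W" "W \<inter> S \<noteq> {}"
  shows "\<exists>V0 V1. openin T V0 \<and> openin T V1 \<and> V0 \<inter> S \<noteq> {} \<and> V1 \<inter> S \<noteq> {} \<and> V0 \<subseteq> W \<and> V1 \<subseteq> W
    \<and> T closure_of V0 \<inter> T closure_of V1 = {}"
proof -
  obtain a where a: "a \<in> W" "a \<in> S" using W by blast
  have "W \<inter> S \<noteq> {a}"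
    using S(2)[OF a(2)] W(1) by (metis Int_commute openin_subtopology_Int2)
  then obtain b where b: "b \<in> W" "b \<in> S" "b \<noteq> a" using a by blast
  obtain P Q where PQ: "openin T P" "openin T Q" "a \<in> P" "b \<in> Q" "disjnt P Q"
    using T(2) a b S(1) unfolding Hausdorff_space_def by (metis subsetD)
  have shrink: "\<exists>V. openin T V \<and> x \<in> V \<and> T closure_of V \<subseteq> O'" if "openin T O'" "x \<in> O'" for x O'
  proof -
    have "closedin T {x}"
      using that Hausdorff_imp_t1_space[OF T(2)] openin_subset[OF that(1)]
      by (simp add: closedin_t1_singleton subset_eq)
    moreover have "{x} \<subseteq> O'" using that(2) by simp
    ultimately have "\<exists>V. openin T V \<and> {x} \<subseteq> V \<and> T closure_of V \<subseteq> O'"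
      using T(1) that(1) unfolding normal_space_alt by blast
    then show ?thesis by simp
  qed
  obtain V0 where V0: "openin T V0" "a \<in> V0" "T closure_of V0 \<subseteq> W \<inter> P"
    using shrink[of "W \<inter> P" a] W(1) PQ a by blast
  obtain V1 where V1: "openin T V1" "b \<in> V1" "T closure_of V1 \<subseteq> W \<inter> Q"
    using shrink[of "W \<inter> Q" b] W(1) PQ b by blast
  have "V0 \<subseteq> T closure_of V0" "V1 \<subseteq> T closure_of V1"
    using V0(1) V1(1) by (auto intro!: closure_of_subset openin_subset)
  then have "V0 \<subseteq> W" "V1 \<subseteq> W" using V0(3) V1(3) by auto
  moreover have "T closure_of V0 \<inter> T closure_of V1 = {}"
    using V0(3) V1(3) PQ(5) by (auto simp: disjnt_iff)
  ultimately show ?thesis using V0 V1 a b by blast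
qed

lemma dense_in_itself_dyadic_tree:
  assumes T: "normal_space T" "Hausdorff_space T"
    and S: "S \<subseteq> topspace T" "S \<noteq> {}" "\<And>x. x \<in> S \<Longrightarrow> \<not> openin (subtopology T S) {x}"
  obtains U :: "bool list \<Rightarrow> 'b set" where "\<And>w. openin T (U w)" "\<And>w. U w \<inter> S \<noteq> {}"
    "\<And>b w. U (b # w) \<subseteq> U w" "\<And>w. T closure_of U (True # w) \<inter> T closure_of U (False # w) = {}"
proof -
  let ?good = "\<lambda>W. openin T W \<and> W \<inter> S \<noteq> {}"
  \<comment> \<open>The splitting is phrased for every set \<open>W\<close>, so that choice yields
    one function \<open>V\<close> that can be iterated.\<close>
  have "\<forall>W. \<exists>V. ?good W \<longrightarrow> (\<forall>b. ?good (V b) \<and> V b \<subseteq> W) \<and> T closure_of V True \<inter> T closure_of V False = {}"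
  proof (intro allI)
    fix W
    show "\<exists>V. ?good W \<longrightarrow> (\<forall>b. ?good (V b) \<and> V b \<subseteq> W) \<and> T closure_of V True \<inter> T closure_of V False = {}"
    proof (cases "?good W")
      case True
      then obtain V0 V1 where "?good V0" "?good V1" "V0 \<subseteq> W" "V1 \<subseteq> W" "T closure_of V0 \<inter> T closure_of V1 = {}"
        using dense_in_itself_split[OF T S(1,3), of W] by blast
      then show ?thesis
        by (intro exI[of _ "\<lambda>b. if b then V0 else V1"]) simp
    next
      case False
      then show ?thesis by blast
    qed
  qed
  then obtain V where V: "\<And>W b. ?good W \<Longrightarrow> ?good (V W b) \<and> V W b \<subseteq> W"
    "\<And>W. ?good W \<Longrightarrow> T closure_of V W True \<inter> T closure_of V W False = {}"
    by metis
  \<comment> \<open>With \<open>foldr\<close> the head of a word is the latest branching, so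
    \<open>b # w\<close> is a child of \<open>w\<close>; the root is the whole space.\<close>
  define U where "U = (\<lambda>w. foldr (\<lambda>b W. V W b) w (topspace T))"
  have U_Cons: "U (b # w) = V (U w) b" for b w by (simp add: U_def)
  have good: "?good (U w)" for w
  proof (induction w)
    case Nil
    then show ?case using S(1,2) by (auto simp: U_def)
  next
    case (Cons b w)
    then show ?case using V(1) by (simp add: U_Cons)
  qed
  show thesis
    by (rule that[of U]) (use good V in \<open>simp_all add: U_Cons\<close>)
qed

text \<open>The average of the point masses at \<open>x v\<close>, where \<open>v\<close> runs over
  the 2^n descendants of \<open>w\<close> that lie \<open>n\<close> levels further down. Recursion
  through the children makes the halving at each level available to induction.\<close>

primrec tree_average :: "(bool list \<Rightarrow> 'b) \<Rightarrow> nat \<Rightarrow> bool list \<Rightarrow> 'b set \<Rightarrow> real" where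
  "tree_average x 0 w E = indicator E (x w)"
| "tree_average x (Suc n) w E = (tree_average x n (True # w) E + tree_average x n (False # w) E) / 2"

lemma tree_average_bounds: "0 \<le> tree_average x n w E" "tree_average x n w E \<le> 1"
proof (induction n arbitrary: w)
  case (Suc n)
  {
    case 1
    show ?case using Suc(1)[of "True # w"] Suc(1)[of "False # w"] by simp
  next
    case 2
    show ?case using Suc(2)[of "True # w"] Suc(2)[of "False # w"] by simp
  }
qed (auto simp: indicator_def)

lemma tree_average_Un:
  "A \<inter> B = {} \<Longrightarrow> tree_average x n w (A \<union> B) = tree_average x n w A + tree_average x n w B"
  by (induction n arbitrary: w) (auto simp: indicator_def add_divide_distrib)

lemma tree_average_mono: "A \<subseteq> B \<Longrightarrow> tree_average x n w A \<le> tree_average x n w B"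
proof (induction n arbitrary: w)
  case (Suc n)
  then show ?case by (simp add: add_mono divide_right_mono)
qed (auto simp: indicator_def)

lemma tree_average_eq_1: "(\<And>w. x w \<in> E) \<Longrightarrow> tree_average x n w E = 1"
  by (induction n arbitrary: w) auto

text \<open>Each averaged point belongs to \<open>U\<close> of a descendant of \<open>w\<close>,
  hence to \<open>U w\<close> by nestedness.\<close>

lemma tree_average_eq_0:
  assumes x: "\<And>w. x w \<in> U w" and U: "\<And>b w. U (b # w) \<subseteq> U w"
  shows "U w \<inter> E = {} \<Longrightarrow> tree_average x n w E = 0"
proof (induction n arbitrary: w)
  case 0
  then show ?case using x[of w] by (auto simp: indicator_def)
next
  case (Suc n)
  have "U (b # w) \<inter> E = {}" for b using U[of b w] Suc.prems by blast
  then show ?case using Suc.IH by simp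
qed

text \<open>At a node \<open>w\<close> the point \<open>p\<close> lies outside the closure of one of
  the two children. Removing that closure kills one half of the average, and the induction
  hypothesis at the other child bounds the other half. One \<open>V\<close> serves all
  \<open>n \<ge> k\<close>, so the bound survives the limit.\<close>

lemma tree_average_small_neighbourhood:
  assumes U: "\<And>w. openin T (U w)" "\<And>b w. U (b # w) \<subseteq> U w"
      "\<And>w. T closure_of U (True # w) \<inter> T closure_of U (False # w) = {}"
    and x: "\<And>w. x w \<in> U w" and p: "p \<in> topspace T"
  shows "\<exists>V. openin T V \<and> p \<in> V \<and> (\<forall>n\<ge>k. tree_average x n w V \<le> (1/2) ^ k)"
proof (induction k arbitrary: w)
  case 0
  show ?case
    by (rule exI[of _ "topspace T"]) (simp add: p tree_average_bounds)
next
  case (Suc k)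
  \<comment> \<open>\<open>b\<close> names the surviving child; its sibling is one whose closure
    misses \<open>p\<close>.\<close>
  obtain b where b: "p \<notin> T closure_of U ((\<not> b) # w)"
  proof (cases "p \<in> T closure_of U (True # w)")
    case True
    then have "p \<notin> T closure_of U (False # w)" using U(3)[of w] by blast
    then show thesis using that[of True] by simp
  next
    case False
    then show thesis using that[of False] by simp
  qed
  obtain V where V: "openin T V" "p \<in> V" "\<And>n. n \<ge> k \<Longrightarrow> tree_average x n (b # w) V \<le> (1/2) ^ k"
    using Suc[of "b # w"] by blast
  let ?V = "V - T closure_of U ((\<not> b) # w)"
  have small: "tree_average x (Suc n) w ?V \<le> (1/2) ^ Suc k" if n: "n \<ge> k" for n
  proof -
    have "U ((\<not> b) # w) \<subseteq> T closure_of U ((\<not> b) # w)"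
      by (intro closure_of_subset openin_subset U)
    then have "tree_average x n ((\<not> b) # w) ?V = 0"
      by (intro tree_average_eq_0[where U = U] x U(2)) blast
    moreover have "tree_average x n (b # w) ?V \<le> (1/2) ^ k"
      using tree_average_mono[of ?V V x n "b # w"] V(3)[OF n] by simp
    ultimately show ?thesis by (cases b) simp_all
  qed
  show ?case
  proof (intro exI[of _ ?V] conjI allI impI)
    show "openin T ?V" using V(1) by (intro openin_diff) auto
    show "p \<in> ?V" using V(2) b by simp
    fix n assume "n \<ge> Suc k"
    \<comment> \<open>Here \<open>n\<close> is positive, and one level is spent on the split at
      \<open>w\<close>, so the estimate is used at depth \<open>n - 1\<close> below the
      children.\<close>
    then show "tree_average x n w ?V \<le> (1/2) ^ Suc k"
      using small[of "n - 1"] by (cases n) simp_all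
  qed
qed

lemma atomless_measure_exists:
  assumes T: "compact_space T" "Hausdorff_space T"
    and K: "compactin T K" "\<not> scattered_space (subtopology T K)"
  obtains \<mu> where "\<mu> \<in> signed_regular_borel_measures T" "total_variation T \<mu> (topspace T - K) = 0"
    "total_variation T \<mu> (topspace T) \<noteq> 0" "\<And>x. x \<in> topspace T \<Longrightarrow> \<mu> {x} = 0"
proof -
  have normal: "normal_space T"
    using T compact_Hausdorff_or_regular_imp_normal_space by blast
  obtain S where S: "S \<subseteq> topspace T \<inter> K" "S \<noteq> {}"
    "\<And>x. x \<in> S \<Longrightarrow> \<not> openin (subtopology (subtopology T K) S) {x}"
    using K(2) unfolding scattered_space_def by auto
  have "subtopology (subtopology T K) S = subtopology T S"
    using S(1) by (simp add: subtopology_subtopology Int_absorb1)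
  then obtain U :: "bool list \<Rightarrow> 'a set" where U: "\<And>w. openin T (U w)" "\<And>w. U w \<inter> S \<noteq> {}"
    "\<And>b w. U (b # w) \<subseteq> U w" "\<And>w. T closure_of U (True # w) \<inter> T closure_of U (False # w) = {}"
    using dense_in_itself_dyadic_tree[OF normal T(2), of S] S by auto
  have "\<forall>w. \<exists>y. y \<in> U w \<inter> S" using U(2) by blast
  then obtain x where x: "\<And>w. x w \<in> U w \<inter> S" by metis
  then have xU: "x w \<in> U w" for w by blast
  obtain F m where F: "F \<noteq> bot" "F \<le> sequentially"
    and m: "\<And>E. ((\<lambda>n. tree_average x n [] E) \<longlongrightarrow> m E) F"
    using pointwise_cluster[of "\<lambda>n. tree_average x n []"] tree_average_bounds[of x]
    by (metis atLeastAtMost_iff)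
  have m0: "0 \<le> m A" for A
    by (rule tendsto_lowerbound[OF m _ F(1)]) (simp add: tree_average_bounds)
  have m1: "m A \<le> 1" for A
    by (rule tendsto_upperbound[OF m _ F(1)]) (simp add: tree_average_bounds)
  have mUn: "m (A \<union> B) = m A + m B" if "A \<inter> B = {}" for A B
    using tendsto_unique[OF F(1) m[of "A \<union> B"]] tendsto_add[OF m[of A] m[of B]] tree_average_Un[OF that]
    by simp
  have mK: "m K = 1"
    using tendsto_unique[OF F(1) m[of K], of 1] x S(1) by (simp add: subset_eq tree_average_eq_1)
  have small: "\<exists>V. openin T V \<and> p \<in> V \<and> m V \<le> (1/2) ^ k" if p: "p \<in> topspace T" for p k
  proof -
    obtain V where V: "openin T V" "p \<in> V" "\<And>n. n \<ge> k \<Longrightarrow> tree_average x n [] V \<le> (1/2) ^ k"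
      using tree_average_small_neighbourhood[OF U(1,3,4) xU p, of k "[]"] by auto
    \<comment> \<open>As \<open>F\<close> is finer than \<open>sequentially\<close>, a bound for all
      \<open>n \<ge> k\<close> holds eventually along \<open>F\<close> and passes to
      \<open>m\<close>.\<close>
    have "eventually (\<lambda>n. tree_average x n [] V \<le> (1/2) ^ k) F"
      using F(2) eventually_ge_at_top[of k] V(3) by (meson eventually_mono filter_leD)
    then have "m V \<le> (1/2) ^ k"
      by (rule tendsto_upperbound[OF m _ F(1)])
    then show ?thesis using V by blast
  qed
  interpret C: additive_content T m
    by unfold_locales (use T m0 mUn in auto)
  define N where "N = C.content_measure"
  interpret N: finite_measure N
    unfolding N_def by (rule C.finite_measure_content_measure)
  note NT = C.finite_measure_content_measure[folded N_def] C.sets_content_measure[folded N_def]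
    C.space_content_measure[folded N_def]
  let ?\<mu> = "restrict (measure N) (borel_sets T)"
  have Kcl: "closedin T K" using T(2) K(1) by (rule compactin_imp_closedin)
  have KN: "K \<in> borel_sets T" by (rule closedin_borel_sets[OF Kcl])
  have top: "topspace T \<in> borel_sets T" by (simp add: openin_borel_sets)
  \<comment> \<open>This bound and \<open>N2\<close> force the complement of \<open>K\<close> to be
    null; this one also makes the measure nonzero.\<close>
  have N1: "measure N K \<ge> 1"
    using C.le_outer[OF Kcl] KN mK
    by (simp add: N_def[symmetric] C.emeasure_content_measure[folded N_def, symmetric] N.emeasure_eq_measure)
  have N2: "measure N (topspace T) \<le> 1"
  proof -
    have "ennreal (measure N (topspace T)) \<le> ennreal (m (topspace T))"
      using C.outer_topspace_le top
      by (simp add: C.emeasure_content_measure[folded N_def, symmetric] N.emeasure_eq_measure)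
    then show ?thesis using m0[of "topspace T"] m1[of "topspace T"] by simp
  qed
  have Ksub: "K \<subseteq> topspace T" by (rule closedin_subset[OF Kcl])
  show thesis
  proof (rule that[of ?\<mu>])
    show "?\<mu> \<in> signed_regular_borel_measures T"
      by (rule restrict_measure_signed_regular[OF NT T C.outer_regular_content_measure[folded N_def]])
    have "measure N (topspace T - K) = measure N (topspace T) - measure N K"
      using top KN Ksub NT by (intro N.finite_measure_Diff) auto
    then have "measure N (topspace T - K) = 0"
      using N1 N2 measure_nonneg[of N "topspace T - K"] by linarith
    moreover have "topspace T - K \<in> borel_sets T"
      using Kcl by (intro openin_borel_sets) (simp add: openin_diff)
    ultimately show "total_variation T ?\<mu> (topspace T - K) = 0"
      by (simp add: total_variation_measure[OF NT(1,2)] N.emeasure_eq_measure)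
    have "measure N (topspace T) \<ge> 1"
      using N1 N.finite_measure_mono[OF Ksub] top NT by simp
    then show "total_variation T ?\<mu> (topspace T) \<noteq> 0"
      by (simp add: total_variation_measure[OF NT(1,2) top] N.emeasure_eq_measure)
    fix p assume p: "p \<in> topspace T"
    have pb: "{p} \<in> borel_sets T"
      using p Hausdorff_imp_t1_space[OF T(2)]
      by (intro closedin_borel_sets) (simp add: closedin_t1_singleton)
    \<comment> \<open>\<open>m V\<close> bounds the open content of \<open>V\<close>, hence the
      measure of \<open>{p}\<close>; letting \<open>k\<close> grow excludes an atom.\<close>
    have "measure N {p} \<le> (1/2) ^ k" for k
    proof -
      obtain V where V: "openin T V" "p \<in> V" "m V \<le> (1/2) ^ k" using small[OF p] by blast
      have "emeasure N {p} \<le> C.open_content V"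
        using V pb C.outer_le_open_content[of V "{p}"] by (simp add: N_def C.emeasure_content_measure)
      also have "\<dots> \<le> ennreal ((1/2) ^ k)"
        using C.open_content_le[of V] V(3) by (meson ennreal_leI order_trans)
      finally show ?thesis by (simp add: N.emeasure_eq_measure)
    qed
    then have "measure N {p} \<le> 0"
      by (intro LIMSEQ_le_const[OF LIMSEQ_power_zero[of "1/2 :: real"]]) auto
    then show "?\<mu> {p} = 0"
      using pb measure_nonneg[of N "{p}"] by simp
  qed
qed

section \<open>Measures on the Stone-Cech compactification\<close>

text \<open>A countable set is the countable union of its singletons, which are compact.\<close>

lemma M_d_subset_M_R: "M_d X \<subseteq> M_R X"
proof -
  have "sigma_compactin X S" if "S \<subseteq> topspace X" "countable S" for S
    unfolding sigma_compactin_def union_of_def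
    by (rule exI[of _ "(\<lambda>x. {x}) ` S"]) (use that in auto)
  then show ?thesis unfolding M_d_def M_R_def by blast
qed

lemma sigma_compactin_subset: "sigma_compactin X S \<Longrightarrow> S \<subseteq> topspace X"
  unfolding sigma_compactin_def union_of_def by (auto dest: compactin_subset_topspace)

text \<open>A sigma-compact \<open>S\<close> lies in \<open>X\<close>, so its image misses the
  remainder and every subset of the remainder is null. This meets the conditions of all three
  classes at once.\<close>

lemma M_R_subset_M_class: "M_R X \<subseteq> M_class p X"
proof
  fix \<mu> assume \<mu>: "\<mu> \<in> M_R X"
  then obtain S where S: "sigma_compactin X S" "concentrated_on (stone_cech X) \<mu> (stone_cech_embed X ` S)"
    unfolding M_R_def by blast
  have "total_variation (stone_cech X) \<mu> K = 0" if "K \<subseteq> stone_cech_remainder X" for K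
    using S(2) unfolding concentrated_on_def
  proof (rule total_variation_null_mono)
    show "K \<subseteq> topspace (stone_cech X) - stone_cech_embed X ` S"
      using that sigma_compactin_subset[OF S(1)] unfolding stone_cech_remainder_def by blast
  qed
  then show "\<mu> \<in> M_class p X"
    using \<mu> by (cases p) (auto simp: M_R_def M_a_def M_sigma_def M_tau_def)
qed

text \<open>Such a measure lives on its atoms: off the countable set \<open>A\<close> of atoms, the
  image of each compact piece of \<open>S\<close> is null by
  \<open>scattered_compactin_null\<close>, and countably many pieces make up
  \<open>S\<close>.\<close>

lemma M_R_subset_M_d:
  assumes X: "completely_regular_space X" "Hausdorff_space X"
    and scattered: "\<And>K. compactin X K \<Longrightarrow> scattered_space (subtopology X K)"
  shows "M_R X \<subseteq> M_d X"
proof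
  let ?T = "stone_cech X" and ?e = "stone_cech_embed X"
  interpret sigma_algebra "topspace ?T" "borel_sets ?T" by (rule sigma_algebra_borel_sets)
  have emb: "embedding_map X ?T ?e" by (rule embedding_map_stone_cech_embed[OF X])
  have cont: "continuous_map X ?T ?e"
    using emb homeomorphic_imp_continuous_map continuous_map_into_fulltopology
    unfolding embedding_map_def by blast
  have H: "Hausdorff_space ?T" by (rule Hausdorff_space_stone_cech)
  fix \<mu> assume \<mu>: "\<mu> \<in> M_R X"
  then have reg: "\<mu> \<in> signed_regular_borel_measures ?T" by (simp add: M_R_def)
  then have fsm: "finite_signed_borel_measure ?T \<mu>" and rb: "regular_borel_measure ?T \<mu>"
    by (auto simp: signed_regular_borel_measures_def)
  obtain S where S: "sigma_compactin X S" and conc: "concentrated_on ?T \<mu> (?e ` S)"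
    using \<mu> by (auto simp: M_R_def)
  obtain \<K> where \<K>: "countable \<K>" "\<And>K. K \<in> \<K> \<Longrightarrow> compactin X K" "\<Union>\<K> = S"
    using S unfolding sigma_compactin_def union_of_def by auto
  have SX: "S \<subseteq> topspace X" by (rule sigma_compactin_subset[OF S])
  define A where "A = {y \<in> topspace ?T. \<mu> {y} \<noteq> 0}"
  have cA: "countable A"
    unfolding A_def by (rule countable_atoms[OF fsm Hausdorff_imp_t1_space[OF H]])
  have "(\<Union>y\<in>A. {y}) \<in> borel_sets ?T"
    by (intro countable_UN'' cA closedin_borel_sets)
       (auto simp: A_def closedin_t1_singleton Hausdorff_imp_t1_space[OF H])
  then have Ab: "A \<in> borel_sets ?T" by simp
  have img: "compactin ?T (?e ` K)" if "K \<in> \<K>" for K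
    by (rule image_compactin[OF \<K>(2)[OF that] cont])
  have eb: "?e ` K \<in> borel_sets ?T" if "K \<in> \<K>" for K
    by (rule closedin_borel_sets[OF compactin_imp_closedin[OF H img[OF that]]])
  \<comment> \<open>Removing the countable set \<open>A\<close> may destroy compactness; inner
    regularity reduces the claim to compact subsets \<open>L\<close>, which contain no
    atoms.\<close>
  have nullK: "total_variation ?T \<mu> (?e ` K - A) = 0" if K: "K \<in> \<K>" for K
  proof (rule regular_null[OF rb])
    show "?e ` K - A \<in> borel_sets ?T" using eb[OF K] Ab by blast
    fix L assume L: "compactin ?T L" "L \<subseteq> ?e ` K - A"
    have "scattered_space (subtopology ?T (?e ` K))"
      using scattered[OF \<K>(2)[OF K]] scattered_space_embedding_map[OF emb]
        compactin_subset_topspace[OF \<K>(2)[OF K]] by blast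
    then show "total_variation ?T \<mu> L = 0"
    proof (rule scattered_compactin_null[OF reg H img[OF K] _ L(1)])
      show "L \<subseteq> ?e ` K" using L(2) by blast
      show "\<mu> {y} = 0" if "y \<in> L" for y
        using that L compactin_subset_topspace[OF L(1)] unfolding A_def by blast
    qed
  qed
  have "total_variation ?T \<mu> (\<Union>((\<lambda>K. ?e ` K - A) ` \<K>)) = 0"
    using nullK eb Ab \<K>(1) by (intro total_variation_null_Union[OF fsm]) auto
  moreover have SA: "\<Union>((\<lambda>K. ?e ` K - A) ` \<K>) = ?e ` S - A" using \<K>(3) by blast
  ultimately have "total_variation ?T \<mu> (?e ` S - A) = 0" by simp
  moreover have "(\<Union>K\<in>\<K>. ?e ` K) \<in> borel_sets ?T"
    by (rule countable_UN''[OF \<K>(1) eb])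
  then have Sb: "?e ` S \<in> borel_sets ?T" using \<K>(3) by (simp flip: image_Union)
  ultimately have "total_variation ?T \<mu> ((topspace ?T - ?e ` S) \<union> (?e ` S - A)) = 0"
    using conc Ab unfolding concentrated_on_def
    by (intro total_variation_null_Un[OF fsm]) auto
  \<comment> \<open>What remains outside these two null sets is the part of the image of
    \<open>S\<close> in \<open>A\<close>.\<close>
  then have "concentrated_on ?T \<mu> (?e ` {x \<in> S. ?e x \<in> A})"
    unfolding concentrated_on_def by (rule total_variation_null_mono) blast
  moreover have "countable {x \<in> S. ?e x \<in> A}"
  proof (rule countable_image_inj_on)
    show "countable (?e ` {x \<in> S. ?e x \<in> A})"
      by (rule countable_subset[OF _ cA]) blast
    show "inj_on ?e {x \<in> S. ?e x \<in> A}"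
    proof (rule inj_on_subset)
      show "inj_on ?e (topspace X)"
        using emb unfolding embedding_map_def by (rule homeomorphic_imp_injective_map)
      show "{x \<in> S. ?e x \<in> A} \<subseteq> topspace X" using SX by blast
    qed
  qed
  moreover have "{x \<in> S. ?e x \<in> A} \<subseteq> topspace X" using SX by blast
  ultimately have "\<exists>C. C \<subseteq> topspace X \<and> countable C \<and> concentrated_on ?T \<mu> (?e ` C)"
    by (intro exI[of _ "{x \<in> S. ?e x \<in> A}"] conjI)
  then show "\<mu> \<in> M_d X"
    using reg by (simp add: M_d_def)
qed

text \<open>A non-scattered compact \<open>K\<close> would carry a nonzero measure without atoms. It
  lies in \<open>M_R X\<close> as \<open>K\<close> is sigma-compact, but concentration on a
  countable set, a countable union of null points, would make it zero.\<close>

lemma M_R_subset_M_d_imp_scattered: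
  assumes X: "completely_regular_space X" "Hausdorff_space X"
    and eq: "M_R X \<subseteq> M_d X" and K: "compactin X K"
  shows "scattered_space (subtopology X K)"
proof (rule ccontr)
  let ?T = "stone_cech X" and ?e = "stone_cech_embed X"
  assume ns: "\<not> scattered_space (subtopology X K)"
  have emb: "embedding_map X ?T ?e" by (rule embedding_map_stone_cech_embed[OF X])
  have cont: "continuous_map X ?T ?e"
    using emb homeomorphic_imp_continuous_map continuous_map_into_fulltopology
    unfolding embedding_map_def by blast
  have H: "Hausdorff_space ?T" by (rule Hausdorff_space_stone_cech)
  have "\<not> scattered_space (subtopology ?T (?e ` K))"
    using ns scattered_space_embedding_map[OF emb] compactin_subset_topspace[OF K] by blast
  then obtain \<mu> where \<mu>: "\<mu> \<in> signed_regular_borel_measures ?T"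
      "total_variation ?T \<mu> (topspace ?T - ?e ` K) = 0" "total_variation ?T \<mu> (topspace ?T) \<noteq> 0"
      "\<And>y. y \<in> topspace ?T \<Longrightarrow> \<mu> {y} = 0"
    using atomless_measure_exists[OF compact_space_stone_cech H image_compactin[OF K cont]] by blast
  have fsm: "finite_signed_borel_measure ?T \<mu>"
    using \<mu>(1) by (simp add: signed_regular_borel_measures_def)
  have "sigma_compactin X K"
    unfolding sigma_compactin_def union_of_def by (rule exI[of _ "{K}"]) (use K in auto)
  then have "\<mu> \<in> M_R X"
    unfolding M_R_def concentrated_on_def using \<mu>(1,2) by blast
  then obtain S where S: "S \<subseteq> topspace X" "countable S" "concentrated_on ?T \<mu> (?e ` S)"
    using eq unfolding M_d_def by blast
  have eS: "?e ` S \<subseteq> topspace ?T"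
    using S(1) continuous_map_image_subset_topspace[OF cont] by blast
  have sing: "{y} \<in> borel_sets ?T" if "y \<in> ?e ` S" for y
    using that eS by (intro closedin_borel_sets) (auto simp: closedin_t1_singleton Hausdorff_imp_t1_space[OF H])
  have "total_variation ?T \<mu> (\<Union>((\<lambda>y. {y}) ` ?e ` S)) = 0"
  proof (rule total_variation_null_Union[OF fsm])
    show "countable ((\<lambda>y. {y}) ` ?e ` S)" using S(2) by simp
    show "(\<lambda>y. {y}) ` ?e ` S \<subseteq> borel_sets ?T" using sing by blast
    fix E assume "E \<in> (\<lambda>y. {y}) ` ?e ` S"
    then show "total_variation ?T \<mu> E = 0"
      using eS \<mu>(4) by (auto intro!: total_variation_singleton_eq_0[OF fsm])
  qed
  then have "total_variation ?T \<mu> (?e ` S) = 0" by simp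
  moreover have eSb: "?e ` S \<in> borel_sets ?T"
  proof -
    interpret sigma_algebra "topspace ?T" "borel_sets ?T" by (rule sigma_algebra_borel_sets)
    have "(\<Union>y\<in>?e ` S. {y}) \<in> borel_sets ?T"
      by (rule countable_UN''[OF countable_image[OF S(2)] sing])
    then show ?thesis by simp
  qed
  moreover have "topspace ?T - ?e ` S \<in> borel_sets ?T"
    using eSb sigma_algebra_borel_sets[of ?T] by (simp add: sigma_algebra_iff2)
  ultimately have "total_variation ?T \<mu> ((topspace ?T - ?e ` S) \<union> ?e ` S) = 0"
    using S(3) unfolding concentrated_on_def by (intro total_variation_null_Un[OF fsm])
  then have "total_variation ?T \<mu> (topspace ?T) = 0"
    by (rule total_variation_null_mono) blast
  then show False using \<mu>(3) by simp
qed

theorem proposition2: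
  fixes X :: "'a topology" and p :: measure_class
  assumes "completely_regular_space X" and "Hausdorff_space X"
  shows "universally_measure_zero p X \<longleftrightarrow>
         universally_measurable p X \<and>
         (\<forall>K. compactin X K \<longrightarrow> scattered_space (subtopology X K))"
proof
  assume "universally_measure_zero p X"
  then have "M_class p X = M_d X" by (simp add: universally_measure_zero_def)
  moreover have "M_d X \<subseteq> M_R X" "M_R X \<subseteq> M_class p X"
    by (rule M_d_subset_M_R M_R_subset_M_class)+
  ultimately have "M_class p X = M_R X" "M_R X \<subseteq> M_d X" by auto
  then show "universally_measurable p X \<and>
      (\<forall>K. compactin X K \<longrightarrow> scattered_space (subtopology X K))"
    using M_R_subset_M_d_imp_scattered[OF assms] by (simp add: universally_measurable_def)
next
  assume "universally_measurable p X \<and>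
      (\<forall>K. compactin X K \<longrightarrow> scattered_space (subtopology X K))"
  then have "M_class p X = M_R X" "M_R X \<subseteq> M_d X"
    using M_R_subset_M_d[OF assms] by (auto simp: universally_measurable_def)
  then show "universally_measure_zero p X"
    using M_d_subset_M_R[of X] by (simp add: universally_measure_zero_def)
qed

end
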